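(* Let $Q$ be a Boolean conjunctive query over a distributed schema and let $\Sigma$ be a set of local existential rules. Then the d-view consisting, for each source $s$, of the $\Sigma$-invariant shuffle views of $Q$ for $s$ is a minimally informative useful d-view for $Q$ within the class of all views, relative to $\Sigma$.
   Context: A distributed schema has finitely many sources with pairwise disjoint local schemas $\mathcal{S}_s$. An existential rule is $\forall\vec x(\lambda\to\exists\vec y\,\rho)$ with $\lambda,\rho$ conjunctions of atoms; it is local if it mentions relations of a single source only. A d-view assigns to each source finitely many views (arbitrary functions of instances of its local schema). Relative to $\Sigma$: $\mathcal{V}$ determines a query if any two d-instances satisfying $\Sigma$ on which all views of $\mathcal{V}$ agree also agree on the query; useful for $Q$ means determines $Q$; $\mathcal{V}$ is minimally informative useful within a class $\mathcal{C}$ relative to $\Sigma$ if it is useful for $Q$ relative to $\Sigma$ and every d-view built from views in $\mathcal{C}$ useful for $Q$ relative to $\Sigma$ determines, relative to $\Sigma$, each view of $\mathcal{V}$. $\mathrm{SJVars}(s,Q)$: variables of $Q$ occurring in an atom over $\mathcal{S}_s$ and in an atom of another source. $\mathrm{CanV}^s(Q)$ (resp. $\mathrm{CanCtxt}^s(Q)$): conjunction of the atoms of $Q$ over (resp. not over) $\mathcal{S}_s$, with variables outside $\mathrm{SJVars}(s,Q)$ existentially quantified. A shuffle is a map $\mu:\mathrm{SJVars}(s,Q)\to\mathrm{SJVars}(s,Q)$ acting by renaming free variables. A type $\tau$ is a complete equality type on $\mathrm{SJVars}(s,Q)$. $\mu$ is $\Sigma$-invariant relative to $\tau$ if for every binding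 $\sigma$ of type $\tau$ and every instance $C$ of the other sources' schemas satisfying $\Sigma$, $C,\sigma\models\mathrm{CanCtxt}^s(Q)$ implies $C,\sigma\models\mu(\mathrm{CanCtxt}^s(Q))$. The $\Sigma$-invariant shuffle view for $s$ and $\tau$ is $\tau\wedge\bigvee_\mu\mu(\mathrm{CanV}^s(Q))$, disjunction over shuffles $\Sigma$-invariant relative to $\tau$ (output: bindings of $\mathrm{SJVars}(s,Q)$ satisfying it). *)

theory Defs
  imports Main "HOL-Library.FuncSet" "HOL-Library.Disjoint_Sets"
begin

text \<open>
  Relation names have type \<open>'r\<close>, sources \<open>'s\<close>, variables \<open>'v\<close>, values \<open>'d\<close>.
  There are no constants in queries and rules.
\<close>

type_synonym ('r, 'v) atom = "'r \<times> 'v list"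
type_synonym ('r, 'd) inst = "('r \<times> 'd list) set"

record ('r, 's) dschema =
  sources :: "'s set"
  local_schema :: "'s \<Rightarrow> 'r set"
  arity :: "'r \<Rightarrow> nat"

definition distributed_schema :: "('r, 's) dschema \<Rightarrow> bool" where
  "distributed_schema \<S> \<longleftrightarrow>
     finite (sources \<S>) \<and> disjoint_family_on (local_schema \<S>) (sources \<S>)"

definition all_rels :: "('r, 's) dschema \<Rightarrow> 'r set" where
  "all_rels \<S> = (\<Union>s\<in>sources \<S>. local_schema \<S> s)"

definition other_rels :: "('r, 's) dschema \<Rightarrow> 's \<Rightarrow> 'r set" where
  "other_rels \<S> s = (\<Union>t\<in>sources \<S> - {s}. local_schema \<S> t)"


subsection \<open>Instances\<close>

definition adom :: "('r, 'd) inst \<Rightarrow> 'd set" where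
  "adom I = (\<Union>(r, ts)\<in>I. set ts)"

text \<open>
  Instances are finite. Finiteness is imposed on the active domain; for a finite schema this is
  the same as having finitely many facts.
\<close>

definition instance_over :: "('r, 's) dschema \<Rightarrow> 'r set \<Rightarrow> ('r, 'd) inst \<Rightarrow> bool" where
  "instance_over \<S> R I \<longleftrightarrow>
     (\<forall>(r, ts)\<in>I. r \<in> R \<and> length ts = arity \<S> r) \<and> finite (adom I)"

definition dinstance :: "('r, 's) dschema \<Rightarrow> ('r, 'd) inst \<Rightarrow> bool" where
  "dinstance \<S> D \<longleftrightarrow> instance_over \<S> (all_rels \<S>) D"

definition local_inst :: "('r, 's) dschema \<Rightarrow> ('r, 'd) inst \<Rightarrow> 's \<Rightarrow> ('r, 'd) inst" where
  "local_inst \<S> D s = {(r, ts)\<in>D. r \<in> local_schema \<S> s}"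


subsection \<open>Conjunctive queries\<close>

definition atom_vars :: "('r, 'v) atom set \<Rightarrow> 'v set" where
  "atom_vars A = (\<Union>(r, xs)\<in>A. set xs)"

definition atoms_over :: "('r, 's) dschema \<Rightarrow> 'r set \<Rightarrow> ('r, 'v) atom set \<Rightarrow> bool" where
  "atoms_over \<S> R A \<longleftrightarrow> finite A \<and> (\<forall>(r, xs)\<in>A. r \<in> R \<and> length xs = arity \<S> r)"

definition atoms_hold :: "('r, 'd) inst \<Rightarrow> ('v \<Rightarrow> 'd) \<Rightarrow> ('r, 'v) atom set \<Rightarrow> bool" where
  "atoms_hold I h A \<longleftrightarrow> (\<forall>(r, xs)\<in>A. (r, map h xs) \<in> I)"

text \<open>\<open>CQ X A\<close>: the conjunction of \<open>A\<close> with all variables outside \<open>X\<close> existentially quantified.\<close>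

datatype ('r, 'v) cq = CQ (free_vars: "'v set") (atoms: "('r, 'v) atom set")

definition cq_holds :: "('r, 'd) inst \<Rightarrow> ('v \<Rightarrow> 'd) \<Rightarrow> ('r, 'v) cq \<Rightarrow> bool" where
  "cq_holds I \<sigma> q \<longleftrightarrow> (\<exists>h. (\<forall>x\<in>free_vars q. h x = \<sigma> x) \<and> atoms_hold I h (atoms q))"

definition bcq :: "('r, 's) dschema \<Rightarrow> ('r, 'v) cq \<Rightarrow> bool" where
  "bcq \<S> Q \<longleftrightarrow> free_vars Q = {} \<and> atoms_over \<S> (all_rels \<S>) (atoms Q)"

definition bcq_holds :: "('r, 'd) inst \<Rightarrow> ('r, 'v) cq \<Rightarrow> bool" where
  "bcq_holds I Q \<longleftrightarrow> (\<exists>h. atoms_hold I h (atoms Q))"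

text \<open>
  Renaming of the free variables. It is only used with maps sending free variables to
  free variables, so no capture can occur.
\<close>

definition rename_free :: "('v \<Rightarrow> 'v) \<Rightarrow> ('r, 'v) cq \<Rightarrow> ('r, 'v) cq" where
  "rename_free \<mu> q =
     CQ (free_vars q)
        ((\<lambda>(r, xs). (r, map (\<lambda>x. if x \<in> free_vars q then \<mu> x else x) xs)) ` atoms q)"


subsection \<open>Existential rules\<close>

text \<open>
  The universally quantified variables of a rule are those of its body; the existentially
  quantified ones are the variables occurring only in its head.
\<close>

datatype ('r, 'v) erule = ERule (body: "('r, 'v) atom set") (head: "('r, 'v) atom set")

definition rule_over :: "('r, 's) dschema \<Rightarrow> 'r set \<Rightarrow> ('r, 'v) erule \<Rightarrow> bool" where
  "rule_over \<S> R \<rho> \<longleftrightarrow> atoms_over \<S> R (body \<rho>) \<and> atoms_over \<S> R (head \<rho>)"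

definition local_rule :: "('r, 's) dschema \<Rightarrow> ('r, 'v) erule \<Rightarrow> bool" where
  "local_rule \<S> \<rho> \<longleftrightarrow> (\<exists>s\<in>sources \<S>. rule_over \<S> (local_schema \<S> s) \<rho>)"

definition rule_holds :: "('r, 'd) inst \<Rightarrow> ('r, 'v) erule \<Rightarrow> bool" where
  "rule_holds I \<rho> \<longleftrightarrow>
     (\<forall>h. atoms_hold I h (body \<rho>) \<longrightarrow>
        (\<exists>h'. (\<forall>x\<in>atom_vars (body \<rho>). h' x = h x) \<and> atoms_hold I h' (head \<rho>)))"

definition satisfies :: "('r, 'd) inst \<Rightarrow> ('r, 'v) erule set \<Rightarrow> bool" where
  "satisfies I \<Sigma> \<longleftrightarrow> (\<forall>\<rho>\<in>\<Sigma>. rule_holds I \<rho>)"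


subsection \<open>Views, determinacy and minimal informativeness\<close>

type_synonym ('r, 'd, 'o) view = "('r, 'd) inst \<Rightarrow> 'o"

definition dview :: "('r, 's) dschema \<Rightarrow> ('s \<Rightarrow> ('r, 'd, 'o) view set) \<Rightarrow> bool" where
  "dview \<S> V \<longleftrightarrow> (\<forall>s\<in>sources \<S>. finite (V s))"

definition views_agree ::
  "('r, 's) dschema \<Rightarrow> ('s \<Rightarrow> ('r, 'd, 'o) view set) \<Rightarrow> ('r, 'd) inst \<Rightarrow> ('r, 'd) inst \<Rightarrow> bool" where
  "views_agree \<S> V D D' \<longleftrightarrow>
     (\<forall>s\<in>sources \<S>. \<forall>v\<in>V s. v (local_inst \<S> D s) = v (local_inst \<S> D' s))"

definition determines ::
  "('r, 's) dschema \<Rightarrow> ('r, 'v) erule set \<Rightarrow> ('s \<Rightarrow> ('r, 'd, 'o) view set) \<Rightarrow>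
   (('r, 'd) inst \<Rightarrow> 'a) \<Rightarrow> bool" where
  "determines \<S> \<Sigma> V q \<longleftrightarrow>
     (\<forall>D D'. dinstance \<S> D \<and> satisfies D \<Sigma> \<and> dinstance \<S> D' \<and> satisfies D' \<Sigma> \<and>
             views_agree \<S> V D D' \<longrightarrow> q D = q D')"

definition useful ::
  "('r, 's) dschema \<Rightarrow> ('r, 'v) erule set \<Rightarrow> ('r, 'w) cq \<Rightarrow>
   ('s \<Rightarrow> ('r, 'd, 'o) view set) \<Rightarrow> bool" where
  "useful \<S> \<Sigma> Q V \<longleftrightarrow> determines \<S> \<Sigma> V (\<lambda>D. bcq_holds D Q)"

text \<open>
  The views of the competing d-views have an output type of their own, \<open>'o\<close>, fixed by the
  class \<open>\<C>\<close>.
\<close>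

definition minimally_informative_useful ::
  "('r, 's) dschema \<Rightarrow> ('r, 'v) erule set \<Rightarrow> ('r, 'd, 'o) view set \<Rightarrow> ('r, 'w) cq \<Rightarrow>
   ('s \<Rightarrow> ('r, 'd, 'p) view set) \<Rightarrow> bool" where
  "minimally_informative_useful \<S> \<Sigma> \<C> Q V \<longleftrightarrow>
     dview \<S> V \<and> useful \<S> \<Sigma> Q V \<and>
     (\<forall>W. dview \<S> W \<and> (\<forall>s\<in>sources \<S>. W s \<subseteq> \<C>) \<and> useful \<S> \<Sigma> Q W \<longrightarrow>
        (\<forall>s\<in>sources \<S>. \<forall>v\<in>V s. determines \<S> \<Sigma> W (\<lambda>D. v (local_inst \<S> D s))))"


subsection \<open>Shuffle views\<close>

definition sjvars :: "('r, 's) dschema \<Rightarrow> 's \<Rightarrow> ('r, 'v) cq \<Rightarrow> 'v set" where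
  "sjvars \<S> s Q =
     atom_vars {a \<in> atoms Q. fst a \<in> local_schema \<S> s} \<inter>
     atom_vars {a \<in> atoms Q. fst a \<in> other_rels \<S> s}"

definition canv :: "('r, 's) dschema \<Rightarrow> 's \<Rightarrow> ('r, 'v) cq \<Rightarrow> ('r, 'v) cq" where
  "canv \<S> s Q = CQ (sjvars \<S> s Q) {a \<in> atoms Q. fst a \<in> local_schema \<S> s}"

definition canctxt :: "('r, 's) dschema \<Rightarrow> 's \<Rightarrow> ('r, 'v) cq \<Rightarrow> ('r, 'v) cq" where
  "canctxt \<S> s Q = CQ (sjvars \<S> s Q) {a \<in> atoms Q. fst a \<notin> local_schema \<S> s}"

abbreviation bindings :: "'v set \<Rightarrow> ('v \<Rightarrow> 'd) set" where
  "bindings X \<equiv> X \<rightarrow>\<^sub>E UNIV"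

abbreviation shuffles :: "'v set \<Rightarrow> ('v \<Rightarrow> 'v) set" where
  "shuffles X \<equiv> X \<rightarrow>\<^sub>E X"

text \<open>
  A complete equality type over \<open>X\<close> is given by the equivalence relation on \<open>X\<close> formed by the
  pairs it declares equal; all other pairs are declared distinct.
\<close>

definition eq_types :: "'v set \<Rightarrow> ('v \<times> 'v) set set" where
  "eq_types X = {\<tau>. equiv X \<tau>}"

definition has_type :: "'v set \<Rightarrow> ('v \<times> 'v) set \<Rightarrow> ('v \<Rightarrow> 'd) \<Rightarrow> bool" where
  "has_type X \<tau> \<sigma> \<longleftrightarrow> (\<forall>x\<in>X. \<forall>y\<in>X. (x, y) \<in> \<tau> \<longleftrightarrow> \<sigma> x = \<sigma> y)"

text \<open>
  An instance \<open>C\<close> of the sources other than \<open>s\<close> is only required to satisfy the rules of \<open>\<Sigma>\<close>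
  over those sources. This matters only for rules of \<open>s\<close> with an empty body.
\<close>

definition invariant_shuffle ::
  "'d itself \<Rightarrow> ('r, 's) dschema \<Rightarrow> ('r, 'v) erule set \<Rightarrow> ('r, 'w) cq \<Rightarrow> 's \<Rightarrow>
   ('w \<times> 'w) set \<Rightarrow> ('w \<Rightarrow> 'w) \<Rightarrow> bool" where
  "invariant_shuffle _ \<S> \<Sigma> Q s \<tau> \<mu> \<longleftrightarrow>
     (\<forall>\<sigma> \<in> bindings (sjvars \<S> s Q). \<forall>C :: ('r, 'd) inst.
        has_type (sjvars \<S> s Q) \<tau> \<sigma> \<and>
        instance_over \<S> (other_rels \<S> s) C \<and>
        satisfies C {\<rho> \<in> \<Sigma>. rule_over \<S> (other_rels \<S> s) \<rho>} \<and>
        cq_holds C \<sigma> (canctxt \<S> s Q) \<longrightarrow>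
        cq_holds C \<sigma> (rename_free \<mu> (canctxt \<S> s Q)))"

definition shuffle_view ::
  "('r, 's) dschema \<Rightarrow> ('r, 'v) erule set \<Rightarrow> ('r, 'w) cq \<Rightarrow> 's \<Rightarrow> ('w \<times> 'w) set \<Rightarrow>
   ('r, 'd, ('w \<Rightarrow> 'd) set) view" where
  "shuffle_view \<S> \<Sigma> Q s \<tau> I =
     {\<sigma> \<in> bindings (sjvars \<S> s Q).
        has_type (sjvars \<S> s Q) \<tau> \<sigma> \<and>
        (\<exists>\<mu> \<in> shuffles (sjvars \<S> s Q).
           invariant_shuffle TYPE('d) \<S> \<Sigma> Q s \<tau> \<mu> \<and>
           cq_holds I \<sigma> (rename_free \<mu> (canv \<S> s Q)))}"

definition shuffle_dview ::
  "('r, 's) dschema \<Rightarrow> ('r, 'v) erule set \<Rightarrow> ('r, 'w) cq \<Rightarrow>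
   's \<Rightarrow> ('r, 'd, ('w \<Rightarrow> 'd) set) view set" where
  "shuffle_dview \<S> \<Sigma> Q s = shuffle_view \<S> \<Sigma> Q s ` eq_types (sjvars \<S> s Q)"

end

theory Submission
  imports Defs
begin

text \<open>
  Usefulness: the sources of one instance can be exchanged for those of the other one at a time,
  since a match of \<open>Q\<close> induces a binding in the view of the exchanged source, and invariance of the
  witnessing shuffle keeps the context of the other sources true.

  Minimality: suppose \<open>\<sigma>\<close> lies in the view of \<open>D\<close> at \<open>s\<close> but not in that of \<open>D'\<close>. Then every
  shuffle \<open>\<mu>\<close> whose image of the canonical view holds in \<open>D'\<close> at \<open>\<sigma>\<close> has a countermodel to
  invariance. Existential rules and conjunctive queries are preserved by direct products, so the
  product \<open>C\<close> of these countermodels is a countermodel to all of them simultaneously. Identifying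
  the diagonal tuples with \<open>\<sigma>\<close> and making all other elements fresh, any match of \<open>Q\<close> in the
  union of \<open>C\<close> with the source \<open>s\<close> of \<open>D'\<close> must map the shared variables into the range of \<open>\<sigma>\<close>,
  that is, via a shuffle. So \<open>Q\<close> fails there, but it holds in the union of \<open>C\<close> with the source \<open>s\<close>
  of \<open>D\<close>, and no d-view on which \<open>D\<close> and \<open>D'\<close> agree can be useful.
\<close>

subsection \<open>Restrictions of instances\<close>

text \<open>Taking any set of relation names lets one operation cover a single source, all other
  sources, and unions and complements of local schemas.\<close>

definition restrict_inst :: "'r set \<Rightarrow> ('r, 'd) inst \<Rightarrow> ('r, 'd) inst" where
  "restrict_inst R I = {f \<in> I. fst f \<in> R}"

lemma local_inst_eq_restrict: "local_inst \<S> D s = restrict_inst (local_schema \<S> s) D"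
  by (auto simp: local_inst_def restrict_inst_def)

lemma instance_over_mono: "instance_over \<S> R I \<Longrightarrow> R \<subseteq> R' \<Longrightarrow> instance_over \<S> R' I"
  by (fastforce simp: instance_over_def)

lemma instance_over_Un:
  "instance_over \<S> R I \<Longrightarrow> instance_over \<S> R J \<Longrightarrow> instance_over \<S> R (I \<union> J)"
  by (auto simp: instance_over_def adom_def)

lemma adom_mono: "I \<subseteq> J \<Longrightarrow> adom I \<subseteq> adom J"
  by (auto simp: adom_def)

lemma instance_over_restrict:
  assumes "instance_over \<S> R' I"
  shows "instance_over \<S> (R' \<inter> R) (restrict_inst R I)"
proof -
  have "adom (restrict_inst R I) \<subseteq> adom I"
    by (rule adom_mono) (auto simp: restrict_inst_def)
  then have "finite (adom (restrict_inst R I))"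
    using assms finite_subset unfolding instance_over_def by blast
  then show ?thesis
    using assms by (auto simp: instance_over_def restrict_inst_def)
qed

lemma atoms_hold_mono: "atoms_hold I h A \<Longrightarrow> I \<subseteq> J \<Longrightarrow> atoms_hold J h A"
  by (fastforce simp: atoms_hold_def)

lemma atoms_hold_cong:
  assumes "\<And>x. x \<in> atom_vars A \<Longrightarrow> g x = h x"
  shows "atoms_hold I g A \<longleftrightarrow> atoms_hold I h A"
proof -
  have "map g (snd a) = map h (snd a)" if "a \<in> A" for a
    using assms that by (fastforce simp: atom_vars_def)
  then show ?thesis
    unfolding atoms_hold_def case_prod_beta by (intro ball_cong) (simp_all only:)
qed

lemma atoms_hold_restrict:
  "fst ` A \<subseteq> R \<Longrightarrow> atoms_hold (restrict_inst R I) h A \<longleftrightarrow> atoms_hold I h A"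
  by (fastforce simp: atoms_hold_def restrict_inst_def)

lemma atoms_hold_adom: "atoms_hold I h A \<Longrightarrow> x \<in> atom_vars A \<Longrightarrow> h x \<in> adom I"
  by (force simp: atoms_hold_def atom_vars_def adom_def)

lemma rule_holds_restrict:
  assumes "rule_over \<S> R \<rho>"
  shows "rule_holds (restrict_inst R I) \<rho> \<longleftrightarrow> rule_holds I \<rho>"
proof -
  have "fst ` body \<rho> \<subseteq> R" "fst ` head \<rho> \<subseteq> R"
    using assms by (auto simp: rule_over_def atoms_over_def)
  then show ?thesis
    by (simp add: rule_holds_def atoms_hold_restrict)
qed

lemma rule_over_mono: "rule_over \<S> R \<rho> \<Longrightarrow> R \<subseteq> R' \<Longrightarrow> rule_over \<S> R' \<rho>"
  by (fastforce simp: rule_over_def atoms_over_def)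

text \<open>A local rule only sees the part of \<open>I\<close> over its own source. The witness
  \<open>J\<close> may vary with the source, which suits instances assembled from several
  others.\<close>

lemma satisfies_if_locally:
  assumes "\<forall>\<rho>\<in>\<Sigma>. local_rule \<S> \<rho>"
    and "\<And>t. t \<in> sources \<S> \<Longrightarrow> \<exists>J. satisfies J {\<rho> \<in> \<Sigma>. rule_over \<S> (local_schema \<S> t) \<rho>} \<and>
      restrict_inst (local_schema \<S> t) I = restrict_inst (local_schema \<S> t) J"
  shows "satisfies I \<Sigma>"
  unfolding satisfies_def
proof
  fix \<rho> assume \<rho>: "\<rho> \<in> \<Sigma>"
  then obtain t where t: "t \<in> sources \<S>" "rule_over \<S> (local_schema \<S> t) \<rho>"
    using assms(1) by (auto simp: local_rule_def)
  obtain J where J: "satisfies J {\<rho> \<in> \<Sigma>. rule_over \<S> (local_schema \<S> t) \<rho>}"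
    "restrict_inst (local_schema \<S> t) I = restrict_inst (local_schema \<S> t) J"
    using assms(2)[OF t(1)] by blast
  then have "rule_holds J \<rho>"
    using \<rho> t by (auto simp: satisfies_def)
  then show "rule_holds I \<rho>"
    using rule_holds_restrict[OF t(2)] J(2) by metis
qed

lemma local_subset_other: "t \<in> sources \<S> \<Longrightarrow> t \<noteq> s \<Longrightarrow> local_schema \<S> t \<subseteq> other_rels \<S> s"
  by (auto simp: other_rels_def)

lemma other_subset_all: "other_rels \<S> s \<subseteq> all_rels \<S>"
  by (auto simp: other_rels_def all_rels_def)

lemma local_disjoint:
  "distributed_schema \<S> \<Longrightarrow> s \<in> sources \<S> \<Longrightarrow> t \<in> sources \<S> \<Longrightarrow> s \<noteq> t \<Longrightarrow>
   local_schema \<S> s \<inter> local_schema \<S> t = {}"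
  by (auto simp: distributed_schema_def disjoint_family_on_def)

lemma local_other_disjoint:
  "distributed_schema \<S> \<Longrightarrow> s \<in> sources \<S> \<Longrightarrow> local_schema \<S> s \<inter> other_rels \<S> s = {}"
  using local_disjoint[of \<S> s] by (fastforce simp: other_rels_def)


subsection \<open>Splitting the query at a source\<close>

lemma cq_holds_mono: "cq_holds I \<sigma> q \<Longrightarrow> I \<subseteq> J \<Longrightarrow> cq_holds J \<sigma> q"
  using atoms_hold_mono unfolding cq_holds_def by blast

text \<open>Capture-free substitution: renaming free variables amounts to precomposing the binding
  with \<open>\<mu>\<close>. Shuffles are handled below in this semantic form.\<close>

lemma cq_holds_rename_free:
  assumes "\<mu> \<in> free_vars q \<rightarrow> free_vars q"
  shows "cq_holds I \<sigma> (rename_free \<mu> q) \<longleftrightarrow> cq_holds I (\<lambda>x. \<sigma> (\<mu> x)) q"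
proof -
  let ?X = "free_vars q"
  have ren: "atoms_hold I h (atoms (rename_free \<mu> q)) \<longleftrightarrow>
      atoms_hold I (\<lambda>x. h (if x \<in> ?X then \<mu> x else x)) (atoms q)" for h
    by (auto simp: atoms_hold_def rename_free_def comp_def split: prod.splits)
  show ?thesis
  proof
    assume "cq_holds I \<sigma> (rename_free \<mu> q)"
    then obtain h where h: "\<forall>x\<in>?X. h x = \<sigma> x" "atoms_hold I h (atoms (rename_free \<mu> q))"
      by (auto simp: cq_holds_def rename_free_def)
    then show "cq_holds I (\<lambda>x. \<sigma> (\<mu> x)) q"
      unfolding cq_holds_def
      by (intro exI[of _ "\<lambda>x. h (if x \<in> ?X then \<mu> x else x)"]) (use assms ren in auto)
  next
    assume "cq_holds I (\<lambda>x. \<sigma> (\<mu> x)) q"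
    then obtain g where g: "\<forall>x\<in>?X. g x = \<sigma> (\<mu> x)" "atoms_hold I g (atoms q)"
      by (auto simp: cq_holds_def)
    \<comment> \<open>Bound variables keep their values under \<open>g\<close>; a renamed free
      variable reads \<open>\<sigma> (\<mu> x)\<close> because \<open>\<mu> x\<close> is free
      again.\<close>
    let ?h = "\<lambda>x. if x \<in> ?X then \<sigma> x else g x"
    have "(\<lambda>x. ?h (if x \<in> ?X then \<mu> x else x)) = g"
      using g(1) assms by (auto simp: fun_eq_iff)
    then have "atoms_hold I ?h (atoms (rename_free \<mu> q))"
      using g(2) by (simp add: ren)
    then show "cq_holds I \<sigma> (rename_free \<mu> q)"
      unfolding cq_holds_def by (intro exI[of _ ?h]) (simp add: rename_free_def)
  qed
qed

lemma canctxt_atoms_other: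
  assumes "bcq \<S> Q"
  shows "fst ` atoms (canctxt \<S> s Q) \<subseteq> other_rels \<S> s"
  using assms by (fastforce simp: canctxt_def bcq_def atoms_over_def all_rels_def other_rels_def)

text \<open>\<open>canctxt\<close> selects atoms by the complement of the local schema,
  \<open>sjvars\<close> by the schemas of the other sources; disjointness makes the two selections
  coincide on the atoms of \<open>Q\<close>.\<close>

lemma shared_vars_canv_canctxt:
  assumes "distributed_schema \<S>" "s \<in> sources \<S>" "bcq \<S> Q"
  shows "sjvars \<S> s Q = atom_vars (atoms (canv \<S> s Q)) \<inter> atom_vars (atoms (canctxt \<S> s Q))"
proof -
  have "{a \<in> atoms Q. fst a \<notin> local_schema \<S> s} = {a \<in> atoms Q. fst a \<in> other_rels \<S> s}"
    using canctxt_atoms_other[OF assms(3), of s] local_other_disjoint[OF assms(1,2)]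
    by (auto simp: canctxt_def)
  then show ?thesis
    by (simp add: sjvars_def canv_def canctxt_def)
qed

text \<open>The two matches overlap only on shared variables, where both follow
  \<open>\<sigma>\<close>, so they glue to a match of the whole query.\<close>

lemma bcq_holds_if_split:
  assumes "distributed_schema \<S>" "s \<in> sources \<S>" "bcq \<S> Q"
    and "cq_holds D \<sigma> (canv \<S> s Q)" "cq_holds D \<sigma> (canctxt \<S> s Q)"
  shows "bcq_holds D Q"
proof -
  let ?X = "sjvars \<S> s Q" and ?A = "atoms (canv \<S> s Q)" and ?B = "atoms (canctxt \<S> s Q)"
  obtain h where h: "\<forall>x\<in>?X. h x = \<sigma> x" "atoms_hold D h ?A"
    using assms(4) by (auto simp: cq_holds_def canv_def)
  obtain k where k: "\<forall>x\<in>?X. k x = \<sigma> x" "atoms_hold D k ?B"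
    using assms(5) by (auto simp: cq_holds_def canctxt_def)
  let ?g = "\<lambda>x. if x \<in> atom_vars ?A then h x else k x"
  have "atoms_hold D ?g ?A"
    using h(2) by (subst atoms_hold_cong[of _ _ h]) auto
  moreover have "atoms_hold D ?g ?B"
    using k(2) h(1) k(1) shared_vars_canv_canctxt[OF assms(1-3)]
    by (subst atoms_hold_cong[of _ _ k]) auto
  ultimately have "atoms_hold D ?g (?A \<union> ?B)"
    by (auto simp: atoms_hold_def)
  moreover have "?A \<union> ?B = atoms Q"
    by (auto simp: canv_def canctxt_def)
  ultimately show ?thesis
    unfolding bcq_holds_def by metis
qed

text \<open>One match of \<open>Q\<close> serves both halves. The two range inclusions are for
  minimality, where shared variables must take values common to both parts.\<close>

lemma bcq_holds_split:
  assumes "distributed_schema \<S>" "s \<in> sources \<S>" "bcq \<S> Q" "bcq_holds D Q"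
  obtains \<sigma> where "cq_holds (restrict_inst (local_schema \<S> s) D) \<sigma> (canv \<S> s Q)"
    and "cq_holds (restrict_inst (other_rels \<S> s) D) \<sigma> (canctxt \<S> s Q)"
    and "\<sigma> ` sjvars \<S> s Q \<subseteq> adom (restrict_inst (local_schema \<S> s) D)"
    and "\<sigma> ` sjvars \<S> s Q \<subseteq> adom (restrict_inst (other_rels \<S> s) D)"
proof -
  let ?L = "restrict_inst (local_schema \<S> s) D" and ?C = "restrict_inst (other_rels \<S> s) D"
  obtain h where h: "atoms_hold D h (atoms Q)"
    using assms(4) by (auto simp: bcq_holds_def)
  have "atoms_hold D h (atoms (canv \<S> s Q))" "atoms_hold D h (atoms (canctxt \<S> s Q))"
    using h by (auto simp: atoms_hold_def canv_def canctxt_def)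
  then have hL: "atoms_hold ?L h (atoms (canv \<S> s Q))"
    and hC: "atoms_hold ?C h (atoms (canctxt \<S> s Q))"
    using canctxt_atoms_other[OF assms(3), of s]
    by (subst atoms_hold_restrict; auto simp: canv_def)+
  show thesis
  proof (rule that[of h])
    show "cq_holds ?L h (canv \<S> s Q)" "cq_holds ?C h (canctxt \<S> s Q)"
      using hL hC by (auto simp: cq_holds_def)
    show "h ` sjvars \<S> s Q \<subseteq> adom ?L" "h ` sjvars \<S> s Q \<subseteq> adom ?C"
      using hL hC shared_vars_canv_canctxt[OF assms(1-3)]
      by (auto intro: atoms_hold_adom)
  qed
qed

lemma finite_sjvars:
  assumes "bcq \<S> Q"
  shows "finite (sjvars \<S> s Q)"
proof -
  have "finite (atoms Q)" using assms by (simp add: bcq_def atoms_over_def)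
  then show ?thesis by (auto simp: sjvars_def atom_vars_def)
qed

text \<open>Lets an arbitrary assignment be replaced by an extensional one, as membership in
  \<open>bindings\<close> demands.\<close>

lemma cq_holds_restrict_free:
  "free_vars q \<subseteq> X \<Longrightarrow> cq_holds I (restrict \<sigma> X) q \<longleftrightarrow> cq_holds I \<sigma> q"
  by (auto simp: cq_holds_def subset_iff)


subsection \<open>Products of instances\<close>

text \<open>
  The elements of the product are coded by the set \<open>E\<close>, with projections \<open>p i\<close>; the coding need
  not be injective.
\<close>

definition coded_product ::
  "'i set \<Rightarrow> ('i \<Rightarrow> ('r, 'd) inst) \<Rightarrow> 'e set \<Rightarrow> ('i \<Rightarrow> 'e \<Rightarrow> 'd) \<Rightarrow> ('r, 'e) inst" where
  "coded_product M C E p =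
     {(r, ts). set ts \<subseteq> E \<and> (\<forall>i\<in>M. (r, map (p i) ts) \<in> C i)}"

text \<open>Surjectivity of the coding: existential witnesses found separately in each factor must
  be realised by a single element of the product.\<close>

definition codes_tuples ::
  "'i set \<Rightarrow> ('i \<Rightarrow> ('r, 'd) inst) \<Rightarrow> 'e set \<Rightarrow> ('i \<Rightarrow> 'e \<Rightarrow> 'd) \<Rightarrow> bool" where
  "codes_tuples M C E p \<longleftrightarrow>
     (\<forall>a \<in> (\<Pi>\<^sub>E i\<in>M. adom (C i)). \<exists>e\<in>E. \<forall>i\<in>M. p i e = a i)"

lemma adom_coded_product: "adom (coded_product M C E p) \<subseteq> E"
  by (auto simp: adom_def coded_product_def)

lemma instance_over_coded_product:
  assumes "i \<in> M" "instance_over \<S> R (C i)" "finite E"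
  shows "instance_over \<S> R (coded_product M C E p)"
proof -
  have "finite (adom (coded_product M C E p))"
    using adom_coded_product assms(3) finite_subset by metis
  then show ?thesis
    using assms(1,2) by (force simp: instance_over_def coded_product_def)
qed

lemma atoms_hold_coded_productD:
  "atoms_hold (coded_product M C E p) h A \<Longrightarrow> i \<in> M \<Longrightarrow> atoms_hold (C i) (p i \<circ> h) A"
  by (fastforce simp: atoms_hold_def coded_product_def)

text \<open>Matches in the factors combine to a match in the product. The values prescribed by
  \<open>k\<close> on \<open>Y\<close> serve to extend a match of a rule body to its head, and to
  fix the free variables of a query.\<close>

lemma atoms_hold_coded_productI:
  assumes "codes_tuples M C E p"
    and hold: "\<And>i. i \<in> M \<Longrightarrow> atoms_hold (C i) (g i) A"
    and k: "k ` Y \<subseteq> E" "\<And>i x. i \<in> M \<Longrightarrow> x \<in> Y \<Longrightarrow> p i (k x) = g i x"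
  obtains h where "\<forall>x\<in>Y. h x = k x" "atoms_hold (coded_product M C E p) h A"
proof -
  have "\<exists>e\<in>E. \<forall>i\<in>M. p i e = g i x" if "x \<in> atom_vars A" for x
  proof -
    have "(\<lambda>i\<in>M. g i x) \<in> (\<Pi>\<^sub>E i\<in>M. adom (C i))"
      using atoms_hold_adom[OF hold that] by auto
    then show ?thesis
      using assms(1) unfolding codes_tuples_def by fastforce
  qed
  then obtain c where c: "\<And>x. x \<in> atom_vars A \<Longrightarrow> c x \<in> E \<and> (\<forall>i\<in>M. p i (c x) = g i x)"
    by metis
  \<comment> \<open>On \<open>Y\<close> the codes come from \<open>k\<close> itself: with a
    non-injective coding, projections do not determine them.\<close>
  let ?h = "\<lambda>x. if x \<in> Y then k x else c x"
  have h: "?h x \<in> E" "\<And>i. i \<in> M \<Longrightarrow> p i (?h x) = g i x" if "x \<in> atom_vars A" for x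
    using c[OF that] k by auto
  have "atoms_hold (coded_product M C E p) ?h A"
    unfolding atoms_hold_def
  proof safe
    fix r xs assume rxs: "(r, xs) \<in> A"
    then have vars: "x \<in> atom_vars A" if "x \<in> set xs" for x
      using that by (auto simp: atom_vars_def)
    have "(r, map (p i) (map ?h xs)) \<in> C i" if "i \<in> M" for i
    proof -
      have "map (p i) (map ?h xs) = map (g i) xs"
        using h(2)[OF vars that] by (simp del: if_split)
      then show ?thesis
        using hold[OF that] rxs unfolding atoms_hold_def by (simp only:) blast
    qed
    moreover have "set (map ?h xs) \<subseteq> E"
      unfolding set_map using h(1)[OF vars] by blast
    ultimately show "(r, map ?h xs) \<in> coded_product M C E p"
      unfolding coded_product_def by blast
  qed
  then show thesis
    by (intro that[of ?h]) auto
qed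

text \<open>A match of the body is projected to each factor, extended to the head there, and the
  extensions are recombined.\<close>

lemma rule_holds_coded_product:
  assumes "codes_tuples M C E p" "\<And>i. i \<in> M \<Longrightarrow> rule_holds (C i) \<rho>"
  shows "rule_holds (coded_product M C E p) \<rho>"
  unfolding rule_holds_def
proof (intro allI impI)
  fix h assume h: "atoms_hold (coded_product M C E p) h (body \<rho>)"
  have "\<exists>g. (\<forall>x\<in>atom_vars (body \<rho>). g x = p i (h x)) \<and> atoms_hold (C i) g (head \<rho>)"
    if "i \<in> M" for i
    using assms(2)[OF that] atoms_hold_coded_productD[OF h that]
    unfolding rule_holds_def by fastforce
  then obtain g where g: "\<And>i. i \<in> M \<Longrightarrow>
      (\<forall>x\<in>atom_vars (body \<rho>). g i x = p i (h x)) \<and> atoms_hold (C i) (g i) (head \<rho>)"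
    by metis
  have "h ` atom_vars (body \<rho>) \<subseteq> E"
    using atoms_hold_adom[OF h] adom_coded_product by fast
  moreover have "p i (h x) = g i x" if "i \<in> M" "x \<in> atom_vars (body \<rho>)" for i x
    using g that by simp
  ultimately obtain h' where "\<forall>x\<in>atom_vars (body \<rho>). h' x = h x"
    "atoms_hold (coded_product M C E p) h' (head \<rho>)"
    using atoms_hold_coded_productI[OF assms(1), of g "head \<rho>" h "atom_vars (body \<rho>)"] g
    by blast
  then show "\<exists>h'. (\<forall>x\<in>atom_vars (body \<rho>). h' x = h x) \<and>
      atoms_hold (coded_product M C E p) h' (head \<rho>)"
    by blast
qed

text \<open>Infinity of \<open>'d\<close> yields a set of fresh codes in bijection with all tuples.
  The values of \<open>\<sigma>\<close> are added as further codes, \<open>\<sigma> x\<close>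
  standing for the tuple of the \<open>\<sigma>' i x\<close>, which may thus have two codes.\<close>

lemma ex_tuple_coding:
  fixes \<sigma> :: "'w \<Rightarrow> 'd" and \<sigma>' :: "'i \<Rightarrow> 'w \<Rightarrow> 'd" and C :: "'i \<Rightarrow> ('r, 'd) inst"
  assumes "infinite (UNIV :: 'd set)" "finite F" "finite X" "finite M"
    and "\<And>i. i \<in> M \<Longrightarrow> finite (adom (C i))"
    and type: "has_type X \<tau> \<sigma>" "\<And>i. i \<in> M \<Longrightarrow> has_type X \<tau> (\<sigma>' i)"
  obtains E :: "'d set" and p where "finite E" "\<sigma> ` X \<subseteq> E" "E \<inter> F \<subseteq> \<sigma> ` X"
    "\<And>i x. i \<in> M \<Longrightarrow> x \<in> X \<Longrightarrow> p i (\<sigma> x) = \<sigma>' i x" "codes_tuples M C E p"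
proof -
  let ?T = "\<Pi>\<^sub>E i\<in>M. adom (C i)"
  have finT: "finite ?T"
    using assms(4,5) by (rule finite_PiE)
  have "infinite (- (F \<union> \<sigma> ` X))"
    using assms(1-3) by (simp only: finite_compl finite_Un finite_imageI simp_thms)
  then obtain B where B: "finite B" "card B = card ?T" "B \<subseteq> - (F \<union> \<sigma> ` X)"
    by (meson infinite_arbitrarily_large)
  then obtain g where g: "bij_betw g ?T B"
    using finT finite_same_card_bij by metis
  define p where "p i e = (if e \<in> \<sigma> ` X then \<sigma>' i (inv_into X \<sigma> e) else inv_into ?T g e i)" for i e
  show thesis
  proof (rule that[of "\<sigma> ` X \<union> B" p])
    show "p i (\<sigma> x) = \<sigma>' i x" if "i \<in> M" "x \<in> X" for i x
    proof -
      have "inv_into X \<sigma> (\<sigma> x) \<in> X" "\<sigma> (inv_into X \<sigma> (\<sigma> x)) = \<sigma> x"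
        using that(2) by (auto intro: inv_into_into f_inv_into_f)
      \<comment> \<open>The inverse may return another variable with the same value under
        \<open>\<sigma>\<close>; the common type \<open>\<tau>\<close> makes
        \<open>\<sigma>' i\<close> agree on the two.\<close>
      then have "\<sigma>' i (inv_into X \<sigma> (\<sigma> x)) = \<sigma>' i x"
        using type(1) type(2)[OF that(1)] that(2) unfolding has_type_def by metis
      then show ?thesis
        using that(2) by (simp add: p_def)
    qed
    have "g a \<in> B" "\<forall>i\<in>M. p i (g a) = a i" if "a \<in> ?T" for a
    proof -
      show "g a \<in> B" using g that by (auto simp: bij_betw_def)
      then have "g a \<notin> \<sigma> ` X" using B(3) by auto
      moreover have "inv_into ?T g (g a) = a"
        using g that by (auto simp: bij_betw_def)
      ultimately show "\<forall>i\<in>M. p i (g a) = a i" by (simp add: p_def)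
    qed
    then show "codes_tuples M C (\<sigma> ` X \<union> B) p"
      unfolding codes_tuples_def by blast
  qed (use assms(3) B in auto)
qed


subsection \<open>The full instance over a finite set\<close>

definition full_inst :: "('r, 's) dschema \<Rightarrow> 'r set \<Rightarrow> 'd set \<Rightarrow> ('r, 'd) inst" where
  "full_inst \<S> R A = {(r, ts). r \<in> R \<and> length ts = arity \<S> r \<and> set ts \<subseteq> A}"

lemma adom_full_inst: "adom (full_inst \<S> R A) \<subseteq> A"
  by (auto simp: adom_def full_inst_def)

lemma instance_over_full_inst: "finite A \<Longrightarrow> instance_over \<S> R (full_inst \<S> R A)"
  using finite_subset[OF adom_full_inst] by (auto simp: instance_over_def full_inst_def)

lemma atoms_hold_full_inst:
  "atoms_over \<S> R B \<Longrightarrow> h ` atom_vars B \<subseteq> A \<Longrightarrow> atoms_hold (full_inst \<S> R A) h B"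
  by (fastforce simp: atoms_over_def atoms_hold_def full_inst_def atom_vars_def)

text \<open>The element \<open>a\<close> is the value given to existential head variables; every
  atom over \<open>A\<close> is then present.\<close>

lemma rule_holds_full_inst:
  assumes "rule_over \<S> R \<rho>" "a \<in> A"
  shows "rule_holds (full_inst \<S> R A) \<rho>"
  unfolding rule_holds_def
proof (intro allI impI)
  fix h assume "atoms_hold (full_inst \<S> R A) h (body \<rho>)"
  then have "h ` atom_vars (body \<rho>) \<subseteq> A"
    using atoms_hold_adom adom_full_inst by fastforce
  then have "(\<lambda>x. if x \<in> atom_vars (body \<rho>) then h x else a) ` atom_vars (head \<rho>) \<subseteq> A"
    using assms(2) by auto
  then have "atoms_hold (full_inst \<S> R A) (\<lambda>x. if x \<in> atom_vars (body \<rho>) then h x else a) (head \<rho>)"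
    using assms(1) unfolding rule_over_def by (blast intro: atoms_hold_full_inst)
  then show "\<exists>h'. (\<forall>x\<in>atom_vars (body \<rho>). h' x = h x) \<and>
      atoms_hold (full_inst \<S> R A) h' (head \<rho>)"
    by (intro exI[of _ "\<lambda>x. if x \<in> atom_vars (body \<rho>) then h x else a"]) auto
qed

text \<open>Provides a harmless factor for shuffles that are already invariant, so that the product
  can range over all shuffles.\<close>

lemma ex_context:
  fixes \<sigma> :: "'w \<Rightarrow> 'd"
  assumes "bcq \<S> Q"
  obtains C :: "('r, 'd) inst" where "instance_over \<S> (other_rels \<S> s) C"
    "satisfies C {\<rho> \<in> \<Sigma>. rule_over \<S> (other_rels \<S> s) \<rho>}" "cq_holds C \<sigma> (canctxt \<S> s Q)"
proof -
  fix d0 :: 'd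
  \<comment> \<open>Adding \<open>d0\<close> keeps the domain nonempty even without shared variables
    and gives bound variables a value.\<close>
  let ?X = "sjvars \<S> s Q" and ?A = "insert d0 (\<sigma> ` sjvars \<S> s Q)"
  let ?K = "full_inst \<S> (other_rels \<S> s) ?A"
  have "atoms_over \<S> (other_rels \<S> s) (atoms (canctxt \<S> s Q))"
    using assms canctxt_atoms_other[OF assms, of s]
    by (fastforce simp: canctxt_def bcq_def atoms_over_def)
  then have "atoms_hold ?K (\<lambda>x. if x \<in> ?X then \<sigma> x else d0) (atoms (canctxt \<S> s Q))"
    by (rule atoms_hold_full_inst) auto
  then have "cq_holds ?K \<sigma> (canctxt \<S> s Q)"
    unfolding cq_holds_def
    by (intro exI[of _ "\<lambda>x. if x \<in> ?X then \<sigma> x else d0"]) (auto simp: canctxt_def)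
  then show thesis
    using that[of ?K] finite_sjvars[OF assms, of s]
    by (auto simp: satisfies_def intro: instance_over_full_inst rule_holds_full_inst)
qed


subsection \<open>Usefulness\<close>

lemma free_vars_canv [simp]: "free_vars (canv \<S> s Q) = sjvars \<S> s Q"
  and free_vars_canctxt [simp]: "free_vars (canctxt \<S> s Q) = sjvars \<S> s Q"
  by (simp_all add: canv_def canctxt_def)

lemma mem_shuffle_view:
  fixes \<sigma> :: "'w \<Rightarrow> 'd" and I :: "('r, 'd) inst"
  shows "\<sigma> \<in> shuffle_view \<S> \<Sigma> Q s \<tau> I \<longleftrightarrow>
    \<sigma> \<in> bindings (sjvars \<S> s Q) \<and> has_type (sjvars \<S> s Q) \<tau> \<sigma> \<and>
    (\<exists>\<mu> \<in> shuffles (sjvars \<S> s Q). invariant_shuffle TYPE('d) \<S> \<Sigma> Q s \<tau> \<mu> \<and>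
      cq_holds I (\<lambda>x. \<sigma> (\<mu> x)) (canv \<S> s Q))"
proof -
  have "cq_holds I \<sigma> (rename_free \<mu> (canv \<S> s Q)) \<longleftrightarrow> cq_holds I (\<lambda>x. \<sigma> (\<mu> x)) (canv \<S> s Q)"
    if "\<mu> \<in> shuffles (sjvars \<S> s Q)" for \<mu>
    using that by (intro cq_holds_rename_free) auto
  then show ?thesis
    unfolding shuffle_view_def by blast
qed

lemma invariant_shuffle_iff:
  assumes "\<mu> \<in> shuffles (sjvars \<S> s Q)"
  shows "invariant_shuffle TYPE('d) \<S> \<Sigma> Q s \<tau> \<mu> \<longleftrightarrow>
    (\<forall>\<sigma> \<in> bindings (sjvars \<S> s Q). \<forall>C :: ('r, 'd) inst.
        has_type (sjvars \<S> s Q) \<tau> \<sigma> \<and>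
        instance_over \<S> (other_rels \<S> s) C \<and>
        satisfies C {\<rho> \<in> \<Sigma>. rule_over \<S> (other_rels \<S> s) \<rho>} \<and>
        cq_holds C \<sigma> (canctxt \<S> s Q) \<longrightarrow>
        cq_holds C (\<lambda>x. \<sigma> (\<mu> x)) (canctxt \<S> s Q))"
proof -
  have "cq_holds C \<sigma> (rename_free \<mu> (canctxt \<S> s Q)) \<longleftrightarrow>
      cq_holds C (\<lambda>x. \<sigma> (\<mu> x)) (canctxt \<S> s Q)" for C :: "('r, 'd) inst" and \<sigma>
    using assms by (intro cq_holds_rename_free) auto
  then show ?thesis
    unfolding invariant_shuffle_def by simp
qed

text \<open>Outside the free variables \<open>restrict id\<close> is \<open>undefined\<close>, but a
  query reads its binding on free variables only.\<close>

lemma identity_shuffle_eq: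
  "cq_holds I (\<lambda>x. \<sigma> (restrict id (free_vars q) x)) q \<longleftrightarrow> cq_holds I \<sigma> q"
  by (auto simp: cq_holds_def)

lemma invariant_identity_shuffle:
  "invariant_shuffle TYPE('d) \<S> \<Sigma> Q s \<tau> (restrict id (sjvars \<S> s Q))"
  using identity_shuffle_eq[where q = "canctxt \<S> s Q"] by (subst invariant_shuffle_iff) auto

text \<open>The identity shuffle puts the binding into the view of \<open>L\<close>, hence of
  \<open>L'\<close>. There some invariant \<open>\<mu>\<close> witnesses membership, and invariance
  moves the context \<open>C\<close> to the same shuffled binding.\<close>

lemma exchange_source:
  fixes L L' C :: "('r, 'd) inst"
  assumes "distributed_schema \<S>" "bcq \<S> Q" "s \<in> sources \<S>"
    and views: "\<forall>v \<in> shuffle_dview \<S> \<Sigma> Q s. v L = v L'"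
    and C: "instance_over \<S> (other_rels \<S> s) C"
      "satisfies C {\<rho> \<in> \<Sigma>. rule_over \<S> (other_rels \<S> s) \<rho>}"
    and hold: "cq_holds L \<sigma> (canv \<S> s Q)" "cq_holds C \<sigma> (canctxt \<S> s Q)"
  shows "bcq_holds (L' \<union> C) Q"
proof -
  let ?X = "sjvars \<S> s Q"
  let ?\<sigma> = "restrict \<sigma> ?X"
  \<comment> \<open>The equality type realised by \<open>\<sigma>\<close> itself selects the view to
    use.\<close>
  define \<tau> where "\<tau> = {(x, y) \<in> ?X \<times> ?X. \<sigma> x = \<sigma> y}"
  have type: "has_type ?X \<tau> ?\<sigma>"
    by (auto simp: has_type_def \<tau>_def)
  have "equiv ?X \<tau>"
    by (rule equivI) (auto simp: \<tau>_def refl_on_def sym_def trans_def)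
  then have eq: "shuffle_view \<S> \<Sigma> Q s \<tau> L = shuffle_view \<S> \<Sigma> Q s \<tau> L'"
    using views by (auto simp: shuffle_dview_def eq_types_def)
  have "cq_holds L ?\<sigma> (canv \<S> s Q)"
    using hold(1) by (simp add: cq_holds_restrict_free)
  then have "cq_holds L (\<lambda>x. ?\<sigma> (restrict id ?X x)) (canv \<S> s Q)"
    using identity_shuffle_eq[where q = "canv \<S> s Q" and \<sigma> = ?\<sigma>] by simp
  then have "?\<sigma> \<in> shuffle_view \<S> \<Sigma> Q s \<tau> L"
    unfolding mem_shuffle_view using type invariant_identity_shuffle
    by (intro conjI bexI[of _ "restrict id ?X"]) auto
  then obtain \<mu> where \<mu>: "\<mu> \<in> shuffles ?X" "invariant_shuffle TYPE('d) \<S> \<Sigma> Q s \<tau> \<mu>"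
    "cq_holds L' (\<lambda>x. ?\<sigma> (\<mu> x)) (canv \<S> s Q)"
    unfolding eq mem_shuffle_view by blast
  have "cq_holds C ?\<sigma> (canctxt \<S> s Q)"
    using hold(2) by (simp add: cq_holds_restrict_free)
  then have "cq_holds C (\<lambda>x. ?\<sigma> (\<mu> x)) (canctxt \<S> s Q)"
    using \<mu>(2) type C restrict_PiE_iff[of \<sigma> ?X "\<lambda>_. UNIV"]
    unfolding invariant_shuffle_iff[OF \<mu>(1)] by blast
  then show ?thesis
    using \<mu>(3) assms(1-3) by (blast intro: bcq_holds_if_split cq_holds_mono)
qed

lemma satisfies_restrict_other:
  "satisfies D \<Sigma> \<Longrightarrow>
   satisfies (restrict_inst R D) {\<rho> \<in> \<Sigma>. rule_over \<S> R \<rho>}"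
  by (auto simp: satisfies_def rule_holds_restrict)

lemma bcq_holds_transfer:
  fixes D D' :: "('r, 'd) inst"
  assumes \<S>: "distributed_schema \<S>" and \<Sigma>: "\<forall>\<rho>\<in>\<Sigma>. local_rule \<S> \<rho>" and Q: "bcq \<S> Q"
    and D: "dinstance \<S> D" "satisfies D \<Sigma>" and D': "dinstance \<S> D'" "satisfies D' \<Sigma>"
    and agree: "views_agree \<S> (shuffle_dview \<S> \<Sigma> Q) D D'" and "bcq_holds D Q"
  shows "bcq_holds D' Q"
proof -
  define U where "U T = (\<Union>t\<in>T. local_schema \<S> t)" for T
  \<comment> \<open>Sources in \<open>T\<close> are taken from \<open>D'\<close>, everything else
    from \<open>D\<close>. Splitting along a complement makes the mix for empty \<open>T\<close>
    equal to \<open>D\<close>.\<close>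
  define mix where "mix T = restrict_inst (U T) D' \<union> restrict_inst (- U T) D" for T
  have mix_local: "restrict_inst (local_schema \<S> t) (mix T) =
      restrict_inst (local_schema \<S> t) (if t \<in> T then D' else D)"
    if "t \<in> sources \<S>" "T \<subseteq> sources \<S>" for t T
  proof (cases "t \<in> T")
    case True
    then show ?thesis by (auto simp: mix_def U_def restrict_inst_def)
  next
    case False
    then have "local_schema \<S> t \<inter> U T = {}"
      using that local_disjoint[OF \<S>] by (fastforce simp: U_def)
    then show ?thesis using False by (auto simp: mix_def restrict_inst_def)
  qed
  have mix_inst: "dinstance \<S> (mix T)" for T
    using D(1) D'(1) unfolding dinstance_def mix_def
    by (intro instance_over_Un) (rule instance_over_mono[OF instance_over_restrict], auto)+
  have mix_sat: "satisfies (mix T) \<Sigma>" if "T \<subseteq> sources \<S>" for T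
  proof (rule satisfies_if_locally[OF \<Sigma>])
    fix t assume t: "t \<in> sources \<S>"
    have "satisfies (if t \<in> T then D' else D) {\<rho> \<in> \<Sigma>. rule_over \<S> (local_schema \<S> t) \<rho>}"
      using D(2) D'(2) by (simp add: satisfies_def)
    then show "\<exists>J. satisfies J {\<rho> \<in> \<Sigma>. rule_over \<S> (local_schema \<S> t) \<rho>} \<and>
        restrict_inst (local_schema \<S> t) (mix T) = restrict_inst (local_schema \<S> t) J"
      using mix_local[OF t that] by blast
  qed
  have "bcq_holds (mix T) Q" if "finite T" "T \<subseteq> sources \<S>" for T
    using that
  proof (induction T rule: finite_induct)
    case empty
    then show ?case
      using \<open>bcq_holds D Q\<close> by (simp add: mix_def U_def restrict_inst_def)
  next
    case (insert s T)
    then have s: "s \<in> sources \<S>" and T: "T \<subseteq> sources \<S>" by auto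
    let ?C = "restrict_inst (other_rels \<S> s) (mix T)"
    obtain \<sigma> where \<sigma>: "cq_holds (restrict_inst (local_schema \<S> s) (mix T)) \<sigma> (canv \<S> s Q)"
      "cq_holds ?C \<sigma> (canctxt \<S> s Q)"
      using bcq_holds_split[OF \<S> s Q] insert.IH T by metis
    have "bcq_holds (local_inst \<S> D' s \<union> ?C) Q"
    proof (rule exchange_source[OF \<S> Q s])
      show "\<forall>v\<in>shuffle_dview \<S> \<Sigma> Q s. v (local_inst \<S> D s) = v (local_inst \<S> D' s)"
        using agree s by (auto simp: views_agree_def)
      show "instance_over \<S> (other_rels \<S> s) ?C"
        using instance_over_mono[OF instance_over_restrict] mix_inst
        unfolding dinstance_def by blast
      show "satisfies ?C {\<rho> \<in> \<Sigma>. rule_over \<S> (other_rels \<S> s) \<rho>}"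
        using mix_sat[OF T] by (rule satisfies_restrict_other)
      \<comment> \<open>As \<open>s\<close> is not yet in \<open>T\<close>, the mix still carries
        the facts of \<open>D\<close> at \<open>s\<close>.\<close>
      show "cq_holds (local_inst \<S> D s) \<sigma> (canv \<S> s Q)"
        using \<sigma>(1) mix_local[OF s T] insert.hyps(2) by (simp add: local_inst_eq_restrict)
    qed (rule \<sigma>(2))
    moreover have "local_inst \<S> D' s \<union> ?C \<subseteq> mix (insert s T)"
      using local_other_disjoint[OF \<S> s]
      by (auto simp: local_inst_eq_restrict mix_def U_def restrict_inst_def)
    ultimately show ?case
      unfolding bcq_holds_def using atoms_hold_mono by blast
  qed
  then have "bcq_holds (mix (sources \<S>)) Q"
    using \<S> by (simp add: distributed_schema_def)
  \<comment> \<open>All facts of \<open>D\<close> are over relations of some source, so none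
    survives once every source is exchanged.\<close>
  moreover have "mix (sources \<S>) \<subseteq> D'"
    using D(1) by (fastforce simp: mix_def U_def restrict_inst_def dinstance_def
        instance_over_def all_rels_def)
  ultimately show ?thesis
    unfolding bcq_holds_def using atoms_hold_mono by blast
qed


subsection \<open>Minimality\<close>

text \<open>A single context refutes all non-invariant shuffles at once, at the given
  \<open>\<sigma>\<close>. The set \<open>F\<close> collects values that its other elements must
  avoid.\<close>

lemma ex_universal_countermodel:
  fixes \<sigma> :: "'w \<Rightarrow> 'd" and \<S> :: "('r, 's) dschema" and \<Sigma> :: "('r, 'v) erule set"
  assumes inf: "infinite (UNIV :: 'd set)" and Q: "bcq \<S> Q" and "finite F"
    and \<sigma>: "\<sigma> \<in> bindings (sjvars \<S> s Q)" "has_type (sjvars \<S> s Q) \<tau> \<sigma>"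
  obtains C :: "('r, 'd) inst" where "instance_over \<S> (other_rels \<S> s) C"
    "satisfies C {\<rho> \<in> \<Sigma>. rule_over \<S> (other_rels \<S> s) \<rho>}"
    "cq_holds C \<sigma> (canctxt \<S> s Q)"
    "adom C \<inter> F \<subseteq> \<sigma> ` sjvars \<S> s Q"
    "\<And>\<mu>. \<mu> \<in> shuffles (sjvars \<S> s Q) \<Longrightarrow> cq_holds C (\<lambda>x. \<sigma> (\<mu> x)) (canctxt \<S> s Q) \<Longrightarrow>
       invariant_shuffle TYPE('d) \<S> \<Sigma> Q s \<tau> \<mu>"
proof -
  let ?X = "sjvars \<S> s Q" and ?R = "other_rels \<S> s"
  let ?\<Sigma> = "{\<rho> \<in> \<Sigma>. rule_over \<S> ?R \<rho>}" and ?ctx = "canctxt \<S> s Q"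
  let ?M = "shuffles ?X"
  have finX: "finite ?X" by (rule finite_sjvars[OF Q])
  then have finM: "finite ?M" by (intro finite_PiE)
  \<comment> \<open>The last conjunct is vacuous for invariant \<open>\<mu>\<close>, so every
    shuffle has a factor of the product.\<close>
  define counter where "counter \<mu> \<sigma>' C \<longleftrightarrow> has_type ?X \<tau> \<sigma>' \<and> instance_over \<S> ?R C \<and>
      satisfies C ?\<Sigma> \<and> cq_holds C \<sigma>' ?ctx \<and>
      (\<not> invariant_shuffle TYPE('d) \<S> \<Sigma> Q s \<tau> \<mu> \<longrightarrow> \<not> cq_holds C (\<lambda>x. \<sigma>' (\<mu> x)) ?ctx)"
    for \<mu> and \<sigma>' :: "'w \<Rightarrow> 'd" and C :: "('r, 'd) inst"
  have "\<exists>\<sigma>' C. counter \<mu> \<sigma>' C" if \<mu>: "\<mu> \<in> ?M" for \<mu>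
  proof (cases "invariant_shuffle TYPE('d) \<S> \<Sigma> Q s \<tau> \<mu>")
    case True
    obtain C :: "('r, 'd) inst" where "instance_over \<S> ?R C" "satisfies C ?\<Sigma>" "cq_holds C \<sigma> ?ctx"
      by (rule ex_context[OF Q]) (rule that)
    then show ?thesis using True \<sigma>(2) unfolding counter_def by blast
  next
    case False
    then obtain \<sigma>' :: "'w \<Rightarrow> 'd" and C :: "('r, 'd) inst" where "has_type ?X \<tau> \<sigma>'"
      "instance_over \<S> ?R C" "satisfies C ?\<Sigma>" "cq_holds C \<sigma>' ?ctx"
      "\<not> cq_holds C (\<lambda>x. \<sigma>' (\<mu> x)) ?ctx"
      unfolding invariant_shuffle_iff[OF \<mu>] by blast
    then show ?thesis unfolding counter_def by blast
  qed
  then obtain \<sigma>' :: "('w \<Rightarrow> 'w) \<Rightarrow> 'w \<Rightarrow> 'd" and C :: "('w \<Rightarrow> 'w) \<Rightarrow> ('r, 'd) inst"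
    where "\<And>\<mu>. \<mu> \<in> ?M \<Longrightarrow> counter \<mu> (\<sigma>' \<mu>) (C \<mu>)"
    by metis
  note ctr = this[unfolded counter_def]
  have fin: "finite (adom (C \<mu>))" and type: "has_type ?X \<tau> (\<sigma>' \<mu>)" if \<mu>: "\<mu> \<in> ?M" for \<mu>
    using ctr[OF \<mu>] by (simp_all add: instance_over_def)
  obtain E :: "'d set" and p where E: "finite E" "\<sigma> ` ?X \<subseteq> E" "E \<inter> F \<subseteq> \<sigma> ` ?X"
    and p: "\<And>\<mu> x. \<mu> \<in> ?M \<Longrightarrow> x \<in> ?X \<Longrightarrow> p \<mu> (\<sigma> x) = \<sigma>' \<mu> x" and codes: "codes_tuples ?M C E p"
    by (rule ex_tuple_coding[OF inf \<open>finite F\<close> finX finM fin \<sigma>(2) type]) (assumption+, rule that)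
  let ?P = "coded_product ?M C E p"
  \<comment> \<open>The index set must be inhabited: an empty product would contain facts of every
    relation and length.\<close>
  have "restrict id ?X \<in> ?M" by auto
  then have "instance_over \<S> ?R ?P"
    using ctr E(1) by (blast intro: instance_over_coded_product)
  moreover have "satisfies ?P ?\<Sigma>"
    using ctr rule_holds_coded_product[OF codes] unfolding satisfies_def by blast
  moreover have "cq_holds ?P \<sigma> ?ctx"
  proof -
    have "\<exists>g. \<forall>\<mu>\<in>?M. (\<forall>x\<in>?X. g \<mu> x = \<sigma>' \<mu> x) \<and> atoms_hold (C \<mu>) (g \<mu>) (atoms ?ctx)"
      using ctr unfolding cq_holds_def free_vars_canctxt by (intro bchoice) blast
    then obtain g where
      "\<forall>\<mu>\<in>?M. (\<forall>x\<in>?X. g \<mu> x = \<sigma>' \<mu> x) \<and> atoms_hold (C \<mu>) (g \<mu>) (atoms ?ctx)"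
      by blast
    then have g: "\<And>\<mu> x. \<mu> \<in> ?M \<Longrightarrow> x \<in> ?X \<Longrightarrow> p \<mu> (\<sigma> x) = g \<mu> x"
      "\<And>\<mu>. \<mu> \<in> ?M \<Longrightarrow> atoms_hold (C \<mu>) (g \<mu>) (atoms ?ctx)"
      using p by simp_all
    obtain h where "\<forall>x\<in>?X. h x = \<sigma> x" "atoms_hold ?P h (atoms ?ctx)"
      by (rule atoms_hold_coded_productI[OF codes g(2) E(2) g(1)]) (assumption | rule that)+
    then show ?thesis
      unfolding cq_holds_def free_vars_canctxt by blast
  qed
  moreover have "adom ?P \<inter> F \<subseteq> \<sigma> ` ?X"
    using adom_coded_product[of ?M C E p] E(3) by auto
  moreover have "invariant_shuffle TYPE('d) \<S> \<Sigma> Q s \<tau> \<mu>"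
    if \<mu>: "\<mu> \<in> ?M" and hold: "cq_holds ?P (\<lambda>x. \<sigma> (\<mu> x)) ?ctx" for \<mu>
  proof -
    obtain h where h: "\<forall>x\<in>?X. h x = \<sigma> (\<mu> x)" "atoms_hold ?P h (atoms ?ctx)"
      using hold unfolding cq_holds_def free_vars_canctxt by blast
    \<comment> \<open>Projecting to the factor of \<open>\<mu>\<close> itself turns the shuffled
      \<open>\<sigma>\<close> into the shuffled \<open>\<sigma>' \<mu>\<close>, which that factor
      refutes unless \<open>\<mu>\<close> is invariant.\<close>
    have "\<forall>x\<in>?X. (p \<mu> \<circ> h) x = \<sigma>' \<mu> (\<mu> x)"
      using h(1) p[OF \<mu>] \<mu> by auto
    then have "cq_holds (C \<mu>) (\<lambda>x. \<sigma>' \<mu> (\<mu> x)) ?ctx"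
      using atoms_hold_coded_productD[OF h(2) \<mu>] unfolding cq_holds_def free_vars_canctxt
      by blast
    then show ?thesis using ctr[OF \<mu>] by blast
  qed
  ultimately show thesis using that by blast
qed

text \<open>One inclusion suffices, since agreement on \<open>W\<close> is symmetric in
  \<open>D\<close> and \<open>D'\<close>.\<close>

lemma shuffle_view_subset:
  fixes D D' :: "('r, 'd) inst" and W :: "'s \<Rightarrow> ('r, 'd, 'o) view set"
  assumes inf: "infinite (UNIV :: 'd set)" and \<S>: "distributed_schema \<S>"
    and \<Sigma>: "\<forall>\<rho>\<in>\<Sigma>. local_rule \<S> \<rho>" and Q: "bcq \<S> Q"
    and W: "useful \<S> \<Sigma> Q W" and s: "s \<in> sources \<S>"
    and D: "dinstance \<S> D" "satisfies D \<Sigma>" and D': "dinstance \<S> D'" "satisfies D' \<Sigma>"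
    and agree: "views_agree \<S> W D D'"
  shows "shuffle_view \<S> \<Sigma> Q s \<tau> (local_inst \<S> D s) \<subseteq> shuffle_view \<S> \<Sigma> Q s \<tau> (local_inst \<S> D' s)"
proof
  let ?X = "sjvars \<S> s Q" and ?R = "other_rels \<S> s" and ?L = "local_schema \<S> s"
  fix \<sigma> :: "'b \<Rightarrow> 'd"
  assume "\<sigma> \<in> shuffle_view \<S> \<Sigma> Q s \<tau> (local_inst \<S> D s)"
  then obtain \<mu> where \<sigma>: "\<sigma> \<in> bindings ?X" "has_type ?X \<tau> \<sigma>"
    and \<mu>: "\<mu> \<in> shuffles ?X" "invariant_shuffle TYPE('d) \<S> \<Sigma> Q s \<tau> \<mu>"
      "cq_holds (local_inst \<S> D s) (\<lambda>x. \<sigma> (\<mu> x)) (canv \<S> s Q)"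
    unfolding mem_shuffle_view by blast
  have fin: "finite (adom D')"
    using D'(1) by (simp add: dinstance_def instance_over_def)
  obtain C :: "('r, 'd) inst" where C: "instance_over \<S> ?R C"
    "satisfies C {\<rho> \<in> \<Sigma>. rule_over \<S> ?R \<rho>}" "cq_holds C \<sigma> (canctxt \<S> s Q)"
    and fresh: "adom C \<inter> adom D' \<subseteq> \<sigma> ` ?X"
    and universal: "\<And>\<mu>. \<mu> \<in> shuffles ?X \<Longrightarrow>
      cq_holds C (\<lambda>x. \<sigma> (\<mu> x)) (canctxt \<S> s Q) \<Longrightarrow> invariant_shuffle TYPE('d) \<S> \<Sigma> Q s \<tau> \<mu>"
    by (rule ex_universal_countermodel[OF inf Q fin \<sigma>, where \<Sigma> = \<Sigma>]) (rule that)
  have C_other: "fst f \<in> ?R" if "f \<in> C" for f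
    using C(1) that by (auto simp: instance_over_def)
  \<comment> \<open>The glued instances of \<open>D\<close> and \<open>D'\<close> share all sources
    but \<open>s\<close>, where the views of \<open>W\<close> agree by assumption; so
    \<open>W\<close> cannot separate them.\<close>
  define glue where "glue B = local_inst \<S> B s \<union> C" for B
  have glue_local: "restrict_inst ?L (glue B) = local_inst \<S> B s"
    and glue_other: "restrict_inst ?R (glue B) = C"
    for B
    using C_other local_other_disjoint[OF \<S> s]
    by (auto simp: glue_def local_inst_eq_restrict restrict_inst_def)
  have glue_at: "restrict_inst (local_schema \<S> t) (glue B) = restrict_inst (local_schema \<S> t) C"
    if "t \<in> sources \<S>" "t \<noteq> s" for t B
    using local_disjoint[OF \<S> s that(1)] that(2)
    by (auto simp: glue_def local_inst_eq_restrict restrict_inst_def)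
  have glue_inst: "dinstance \<S> (glue B)" if "dinstance \<S> B" for B
    unfolding dinstance_def glue_def local_inst_eq_restrict
  proof (rule instance_over_Un)
    show "instance_over \<S> (all_rels \<S>) (restrict_inst ?L B)"
      using that instance_over_mono[OF instance_over_restrict] unfolding dinstance_def by blast
    show "instance_over \<S> (all_rels \<S>) C"
      using C(1) other_subset_all instance_over_mono by metis
  qed
  have glue_sat: "satisfies (glue B) \<Sigma>" if "satisfies B \<Sigma>" for B
  proof (rule satisfies_if_locally[OF \<Sigma>])
    fix t assume t: "t \<in> sources \<S>"
    show "\<exists>J. satisfies J {\<rho> \<in> \<Sigma>. rule_over \<S> (local_schema \<S> t) \<rho>} \<and>
        restrict_inst (local_schema \<S> t) (glue B) = restrict_inst (local_schema \<S> t) J"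
    proof (cases "t = s")
      case True
      then show ?thesis
        using that glue_local by (auto simp: satisfies_def local_inst_eq_restrict)
    next
      case False
      then have "satisfies C {\<rho> \<in> \<Sigma>. rule_over \<S> (local_schema \<S> t) \<rho>}"
        using C(2) rule_over_mono[OF _ local_subset_other[OF t]] by (auto simp: satisfies_def)
      then show ?thesis using glue_at[OF t False] by blast
    qed
  qed
  have "views_agree \<S> W (glue D) (glue D')"
    unfolding views_agree_def
  proof (intro ballI)
    fix t v assume t: "t \<in> sources \<S>" and v: "v \<in> W t"
    show "v (local_inst \<S> (glue D) t) = v (local_inst \<S> (glue D') t)"
    proof (cases "t = s")
      case True
      then show ?thesis
        using agree t v glue_local by (simp add: views_agree_def local_inst_eq_restrict)
    next
      case False
      then show ?thesis
        using glue_at[OF t False] by (simp add: local_inst_eq_restrict)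
    qed
  qed
  moreover have "bcq_holds (glue D) Q"
  proof -
    have "cq_holds C (\<lambda>x. \<sigma> (\<mu> x)) (canctxt \<S> s Q)"
      using \<mu>(2) \<sigma> C unfolding invariant_shuffle_iff[OF \<mu>(1)] by blast
    then show ?thesis
      unfolding glue_def using \<mu>(3) \<S> Q s by (blast intro: bcq_holds_if_split cq_holds_mono)
  qed
  ultimately have holds: "bcq_holds (glue D') Q"
    using W glue_inst glue_sat D D' unfolding useful_def determines_def by blast
  obtain \<nu> where \<nu>: "cq_holds (local_inst \<S> D' s) \<nu> (canv \<S> s Q)"
    "cq_holds C \<nu> (canctxt \<S> s Q)"
    and \<nu>_adom: "\<nu> ` ?X \<subseteq> adom (local_inst \<S> D' s)" "\<nu> ` ?X \<subseteq> adom C"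
    by (rule bcq_holds_split[OF \<S> s Q holds, unfolded glue_local glue_other]) (rule that)
  have "adom (local_inst \<S> D' s) \<subseteq> adom D'"
    by (rule adom_mono) (auto simp: local_inst_def)
  \<comment> \<open>A shared variable takes a value in both \<open>C\<close> and \<open>D'\<close>,
    which freshness confines to the range of \<open>\<sigma>\<close>. Choosing preimages makes
    \<open>\<nu>\<close> a shuffle of \<open>\<sigma>\<close>.\<close>
  then have "\<forall>x\<in>?X. \<exists>y\<in>?X. \<sigma> y = \<nu> x"
    using \<nu>_adom fresh by fastforce
  then obtain m where m: "\<forall>x\<in>?X. m x \<in> ?X \<and> \<sigma> (m x) = \<nu> x"
    by metis
  let ?m = "restrict m ?X"
  have m_shuffle: "?m \<in> shuffles ?X" and "\<forall>x\<in>?X. \<sigma> (?m x) = \<nu> x"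
    using m by auto
  then have "cq_holds I (\<lambda>x. \<sigma> (?m x)) q \<longleftrightarrow> cq_holds I \<nu> q" if "free_vars q = ?X"
    for q and I :: "('r, 'd) inst"
    using that unfolding cq_holds_def by simp
  then have "cq_holds (local_inst \<S> D' s) (\<lambda>x. \<sigma> (?m x)) (canv \<S> s Q)"
    "cq_holds C (\<lambda>x. \<sigma> (?m x)) (canctxt \<S> s Q)"
    using \<nu> by auto
  \<comment> \<open>The context holds in \<open>C\<close> at the shuffled binding, so universality
    of \<open>C\<close> makes \<open>?m\<close> invariant.\<close>
  then show "\<sigma> \<in> shuffle_view \<S> \<Sigma> Q s \<tau> (local_inst \<S> D' s)"
    unfolding mem_shuffle_view using \<sigma> m_shuffle universal by blast
qed

lemma finite_eq_types: "finite X \<Longrightarrow> finite (eq_types X)"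
  by (rule finite_subset[of _ "Pow (X \<times> X)"]) (auto simp: eq_types_def equiv_def refl_on_def)

theorem mainTheorem8:
  fixes \<S> :: "('r, 's) dschema"
    and \<Sigma> :: "('r, 'v) erule set"
    and Q :: "('r, 'w) cq"
  assumes "infinite (UNIV :: 'd set)"
    and "distributed_schema \<S>"
    and "\<forall>\<rho>\<in>\<Sigma>. local_rule \<S> \<rho>"
    and "bcq \<S> Q"
  shows "minimally_informative_useful \<S> \<Sigma> (UNIV :: ('r, 'd, 'o) view set) Q
           (shuffle_dview \<S> \<Sigma> Q :: 's \<Rightarrow> ('r, 'd, ('w \<Rightarrow> 'd) set) view set)"
  unfolding minimally_informative_useful_def
proof (intro conjI allI impI ballI)
  show "dview \<S> (shuffle_dview \<S> \<Sigma> Q :: 's \<Rightarrow> ('r, 'd, ('w \<Rightarrow> 'd) set) view set)"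
    using finite_eq_types[OF finite_sjvars[OF assms(4)]]
    by (simp add: dview_def shuffle_dview_def)
  show "useful \<S> \<Sigma> Q (shuffle_dview \<S> \<Sigma> Q :: 's \<Rightarrow> ('r, 'd, ('w \<Rightarrow> 'd) set) view set)"
    unfolding useful_def determines_def
  proof (intro allI impI)
    fix D D' :: "('r, 'd) inst"
    assume *: "dinstance \<S> D \<and> satisfies D \<Sigma> \<and> dinstance \<S> D' \<and> satisfies D' \<Sigma> \<and>
      views_agree \<S> (shuffle_dview \<S> \<Sigma> Q) D D'"
    then have "views_agree \<S> (shuffle_dview \<S> \<Sigma> Q) D' D"
      unfolding views_agree_def by metis
    then show "bcq_holds D Q = bcq_holds D' Q"
      using * bcq_holds_transfer[OF assms(2-4)] by blast
  qed
next
  fix W :: "'s \<Rightarrow> ('r, 'd, 'o) view set" and s and v :: "('r, 'd, ('w \<Rightarrow> 'd) set) view"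
  assume W: "dview \<S> W \<and> (\<forall>s\<in>sources \<S>. W s \<subseteq> UNIV) \<and> useful \<S> \<Sigma> Q W"
    and s: "s \<in> sources \<S>" and "v \<in> shuffle_dview \<S> \<Sigma> Q s"
  then obtain \<tau> where v: "v = shuffle_view \<S> \<Sigma> Q s \<tau>"
    by (auto simp: shuffle_dview_def)
  show "determines \<S> \<Sigma> W (\<lambda>D. v (local_inst \<S> D s))"
    unfolding determines_def v
  proof (intro allI impI equalityI)
    fix D D' :: "('r, 'd) inst"
    assume *: "dinstance \<S> D \<and> satisfies D \<Sigma> \<and> dinstance \<S> D' \<and> satisfies D' \<Sigma> \<and>
      views_agree \<S> W D D'"
    then have "views_agree \<S> W D' D"
      unfolding views_agree_def by metis
    then show "shuffle_view \<S> \<Sigma> Q s \<tau> (local_inst \<S> D s)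
        \<subseteq> shuffle_view \<S> \<Sigma> Q s \<tau> (local_inst \<S> D' s)"
      "shuffle_view \<S> \<Sigma> Q s \<tau> (local_inst \<S> D' s)
        \<subseteq> shuffle_view \<S> \<Sigma> Q s \<tau> (local_inst \<S> D s)"
      using * W s shuffle_view_subset[OF assms] by blast+
  qed
qed

end
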